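(* Let $p$ be any prime. If $G$ is a finite $(p+2)$-centralizer $p$-group, then the non-commuting graph $\mathcal{A}_G$ is L-integral.
   Context: A finite group $G$ is an $n$-centralizer group if the set $\{C_G(x) : x \in G\}$ of element centralizers has exactly $n$ distinct members (including $G = C_G(1)$). For a finite non-abelian group $G$ with centre $Z(G)$, the non-commuting graph $\mathcal{A}_G$ is the simple undirected graph with vertex set $G \setminus Z(G)$ in which two vertices $x,y$ are adjacent if and only if $xy \neq yx$. A finite graph is L-integral if all eigenvalues of its Laplacian matrix $D - A$ ($D$ the degree matrix, $A$ the adjacency matrix) are integers. *)

theory Defs
  imports
    "HOL-Algebra.Coset"
    "HOL-Computational_Algebra.Primes"
    "Graph_Theory.Graph_Theory"
    "Jordan_Normal_Form.Char_Poly"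
begin

definition centralizer :: "('a, 'b) monoid_scheme \<Rightarrow> 'a \<Rightarrow> 'a set" where
  "centralizer G x = {y \<in> carrier G. x \<otimes>\<^bsub>G\<^esub> y = y \<otimes>\<^bsub>G\<^esub> x}"

definition center :: "('a, 'b) monoid_scheme \<Rightarrow> 'a set" where
  "center G = {z \<in> carrier G. \<forall>y \<in> carrier G. z \<otimes>\<^bsub>G\<^esub> y = y \<otimes>\<^bsub>G\<^esub> z}"

definition n_centralizer_group :: "nat \<Rightarrow> ('a, 'b) monoid_scheme \<Rightarrow> bool" where
  "n_centralizer_group n G \<longleftrightarrow>
    group G \<and> finite (carrier G) \<and> card (centralizer G ` carrier G) = n"

definition finite_p_group :: "nat \<Rightarrow> ('a, 'b) monoid_scheme \<Rightarrow> bool" where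
  "finite_p_group p G \<longleftrightarrow> group G \<and> finite (carrier G) \<and> (\<exists>k. Coset.order G = p ^ k)"

text \<open>
  A simple undirected graph is a \<^locale>\<open>pair_graph\<close>: a finite, loop-free digraph in which
  every edge is represented by both of its orientations.
\<close>

definition non_commuting_graph :: "('a, 'b) monoid_scheme \<Rightarrow> 'a pair_pre_digraph" where
  "non_commuting_graph G =
    \<lparr> pverts = carrier G - center G,
      parcs = {(x, y). x \<in> carrier G - center G \<and> y \<in> carrier G - center G \<and>
                       x \<otimes>\<^bsub>G\<^esub> y \<noteq> y \<otimes>\<^bsub>G\<^esub> x} \<rparr>"

lemma pair_graph_non_commuting_graph:
  assumes "finite (carrier G)"
  shows "pair_graph (non_commuting_graph G)"
proof -
  have "finite (parcs (non_commuting_graph G))"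
    by (rule finite_subset[of _ "carrier G \<times> carrier G"])
      (auto simp: non_commuting_graph_def assms)
  then show ?thesis
    by unfold_locales
      (auto simp: non_commuting_graph_def assms symmetric_def arcs_ends_def arc_to_ends_def
        with_proj_def sym_def image_iff)
qed

text \<open>
  The matrices of a graph are taken with respect to a list \<open>vs\<close> enumerating the vertices
  without repetition. Since every edge is present in both orientations, the out-degree of a
  vertex is its degree in the undirected graph.
\<close>

definition adjacency_mat :: "'a pair_pre_digraph \<Rightarrow> 'a list \<Rightarrow> complex mat" where
  "adjacency_mat D vs =
    mat (length vs) (length vs) (\<lambda>(i, j). if (vs ! i, vs ! j) \<in> parcs D then 1 else 0)"

definition degree_mat :: "'a pair_pre_digraph \<Rightarrow> 'a list \<Rightarrow> complex mat" where
  "degree_mat D vs =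
    mat (length vs) (length vs)
      (\<lambda>(i, j). if i = j then of_nat (out_degree (with_proj D) (vs ! i)) else 0)"

definition laplacian_mat :: "'a pair_pre_digraph \<Rightarrow> 'a list \<Rightarrow> complex mat" where
  "laplacian_mat D vs = degree_mat D vs - adjacency_mat D vs"

text \<open>
  Different enumerations give permutation-similar Laplacian matrices, so quantifying over all
  of them is the same as choosing one; a finite vertex set has at least one.
\<close>

definition L_integral :: "'a pair_pre_digraph \<Rightarrow> bool" where
  "L_integral D \<longleftrightarrow> pair_graph D \<and>
    (\<forall>vs. distinct vs \<and> set vs = pverts D \<longrightarrow>
      (\<forall>k. eigenvalue (laplacian_mat D vs) k \<longrightarrow> k \<in> \<int>))"

end

theory Submission
  imports Defs
begin

text \<open>
  The \<open>p + 1\<close> proper centralizers cover \<open>G\<close>, and each of them has index at least \<open>p\<close>. Counting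
  the elements outside a subgroup of index \<open>p\<close> shows that such a cover is tight: all members have
  index \<open>p\<close>, and outside any one of them the others are disjoint. Hence two distinct proper
  centralizers meet only in the centre, so commuting is transitive on noncentral elements, i.e.
  the non-commuting graph is complete multipartite. For an eigenvector \<open>v\<close> of the Laplacian of a
  complete multipartite graph on \<open>n\<close> vertices, summing the eigenvalue equation over all vertices
  and over a part leaves only the eigenvalues \<open>0\<close>, \<open>n\<close> and \<open>n - c\<close> with \<open>c\<close> the size of a part.
\<close>

section \<open>Covering a \<open>p\<close>-group by \<open>p + 1\<close> proper subgroups\<close>

text \<open>The product map from \<open>H \<times> K\<close> to \<open>G\<close> has fibres of size
  at most \<open>card (H \<inter> K)\<close>: if \<open>c \<otimes> d = a \<otimes> b\<close>, then
  \<open>inv a \<otimes> c = b \<otimes> inv d\<close> lies in both subgroups, and it determines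
  \<open>(c, d)\<close> once \<open>(a, b)\<close> is fixed.\<close>

lemma (in group) card_mult_subgroups_le:
  assumes "finite (carrier G)" "subgroup H G" "subgroup K G"
  shows "card H * card K \<le> card (carrier G) * card (H \<inter> K)"
proof -
  interpret H: subgroup H G by fact
  interpret K: subgroup K G by fact
  have fin: "finite H" "finite K"
    using assms(1) H.subset K.subset finite_subset by blast+
  define F where "F g = {q \<in> H \<times> K. fst q \<otimes> snd q = g}" for g
  have F_le: "card (F g) \<le> card (H \<inter> K)" for g
  proof (cases "F g = {}")
    case False
    then obtain a b where ab: "a \<in> H" "b \<in> K" "a \<otimes> b = g" by (auto simp: F_def)
    have abG: "a \<in> carrier G" "b \<in> carrier G" using ab by auto
    have inj: "inj_on (\<lambda>q. inv a \<otimes> fst q) (F g)"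
    proof (rule inj_onI)
      fix q r assume q: "q \<in> F g" and r: "r \<in> F g" and eq: "inv a \<otimes> fst q = inv a \<otimes> fst r"
      have "fst q \<in> carrier G" "fst r \<in> carrier G" "snd q \<in> carrier G" "snd r \<in> carrier G"
        using q r by (auto simp: F_def)
      moreover from this eq have "fst q = fst r" using abG by simp
      moreover have "fst q \<otimes> snd q = fst r \<otimes> snd r" using q r by (simp add: F_def)
      ultimately show "q = r" by (simp add: prod_eq_iff)
    qed
    have "(\<lambda>q. inv a \<otimes> fst q) ` F g \<subseteq> H \<inter> K"
    proof safe
      fix c d assume "(c, d) \<in> F g"
      then have cd: "c \<in> H" "d \<in> K" "c \<otimes> d = a \<otimes> b" by (auto simp: F_def ab)
      then have cdG: "c \<in> carrier G" "d \<in> carrier G" by auto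
      show "inv a \<otimes> fst (c, d) \<in> H" using cd ab by simp
      have "inv a \<otimes> c = b \<otimes> inv d"
        using cd(3) abG cdG by (metis inv_closed inv_solve_left inv_solve_right m_assoc m_closed)
      then show "inv a \<otimes> fst (c, d) \<in> K" using cd ab by simp
    qed
    then show ?thesis using inj fin by (meson card_inj_on_le finite_Int)
  qed simp
  have "H \<times> K = (\<Union>g\<in>carrier G. F g)" by (auto simp: F_def)
  then have "card H * card K \<le> (\<Sum>g\<in>carrier G. card (F g))"
    by (metis assms(1) card_UN_le card_cartesian_product)
  also have "\<dots> \<le> (\<Sum>g\<in>carrier G. card (H \<inter> K))" by (rule sum_mono) (rule F_le)
  finally show ?thesis by simp
qed

text \<open>The index is a power of \<open>p\<close> other than 1. The gap between \<open>p\<close>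
  and \<open>p * p\<close> is what later forces a cover by few subgroups to have a member of index
  exactly \<open>p\<close>.\<close>

lemma (in group) card_proper_subgroup_p_group:
  assumes "prime p" "finite (carrier G)" "Coset.order G = p ^ k" "subgroup H G" "H \<noteq> carrier G"
  shows "p * card H = card (carrier G) \<or> p * p * card H \<le> card (carrier G)"
proof -
  have "card H dvd p ^ k"
    using lagrange_finite[OF assms(2,4)] assms(3) by (metis dvd_triv_right)
  then obtain j where j: "j \<le> k" "card H = p ^ j"
    using assms(1) by (auto simp: divides_primepow_nat)
  have "j \<noteq> k"
    using j assms by (metis card_subset_eq Coset.order_def subgroup.subset)
  then have "Suc j = k \<or> Suc (Suc j) \<le> k" using j by linarith
  then show ?thesis
  proof
    assume "Suc j = k"
    then show ?thesis using j(2) assms(3) by (auto simp: Coset.order_def)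
  next
    assume "Suc (Suc j) \<le> k"
    then have "p ^ Suc (Suc j) \<le> p ^ k"
      using assms(1) by (intro power_increasing prime_ge_1_nat)
    then show ?thesis using j(2) assms(3) by (simp add: Coset.order_def mult.assoc)
  qed
qed

text \<open>Each of the \<open>p\<close> members other than \<open>H\<close> has at least a
  \<open>1/p\<close> fraction of its elements inside \<open>H\<close>, so it covers at most
  \<open>1/p\<close> of \<open>carrier G - H\<close>. Together they must cover all of it, so no
  bound has any slack and no element outside \<open>H\<close> may be covered twice. The inequalities
  are multiplied out by powers of \<open>p\<close> to avoid division.\<close>

lemma (in group) subgroup_cover_tight:
  assumes p: "prime p" and fin: "finite (carrier G)"
    and card_F: "card F = p + 1" and cover: "carrier G \<subseteq> \<Union>F"
    and sub: "\<And>K. K \<in> F \<Longrightarrow> subgroup K G"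
    and small: "\<And>K. K \<in> F \<Longrightarrow> p * card K \<le> card (carrier G)"
    and H: "H \<in> F" and H_index: "p * card H = card (carrier G)"
  shows "K \<in> F \<Longrightarrow> p * card K = card (carrier G)"
    and "\<lbrakk>K \<in> F; L \<in> F; K \<noteq> L; K \<noteq> H; L \<noteq> H\<rbrakk> \<Longrightarrow> K \<inter> L \<subseteq> H"
proof -
  let ?N = "card (carrier G)" and ?F = "F - {H}"
  have p2: "p \<ge> 2" using p by (rule prime_ge_2_nat)
  have N_pos: "?N > 0" using fin by (metis card_gt_0_iff empty_iff one_closed)
  have finF: "finite F" using card_F by (metis Suc_eq_plus1 card.infinite nat.distinct(1))
  have card_F': "card ?F = p" using card_F H finF by simp
  have fin_mem: "finite K" if "K \<in> F" for K
    using sub[OF that] fin by (meson finite_subset subgroup.subset)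
  have split: "card (K - H) + card (K \<inter> H) = card K" if "K \<in> F" for K
    using fin_mem[OF that] by (metis add.commute card_Diff_subset_Int card_mono finite_Int
        inf_le1 le_add_diff_inverse)
  \<comment> \<open>The bound on \<open>card K * card H\<close>, with
    \<open>card (carrier G)\<close> replaced by \<open>p * card H\<close> and the factor
    \<open>card H\<close> cancelled.\<close>
  have int: "card K \<le> p * card (K \<inter> H)" if K: "K \<in> F" for K
  proof -
    have "card K * card H \<le> (p * card (K \<inter> H)) * card H"
      using card_mult_subgroups_le[OF fin sub[OF K] sub[OF H]]
      by (simp only: H_index[symmetric] ac_simps)
    moreover have "card H > 0" using H_index N_pos by (metis mult_0_right neq0_conv)
    ultimately show ?thesis by simp
  qed
  have diff: "p * card (K - H) \<le> (p - 1) * card K" if K: "K \<in> F" for K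
  proof -
    have "p * card (K - H) + p * card (K \<inter> H) = p * card K"
      using split[OF K] by (metis distrib_left)
    then show ?thesis using int[OF K] by (simp add: diff_mult_distrib)
  qed
  have diff': "p * (p * card (K - H)) \<le> (p - 1) * ?N" if K: "K \<in> F" for K
  proof -
    have "p * (p * card (K - H)) \<le> p * ((p - 1) * card K)" using diff[OF K] by simp
    also have "\<dots> = (p - 1) * (p * card K)" by simp
    also have "\<dots> \<le> (p - 1) * ?N" using small[OF K] by simp
    finally show ?thesis .
  qed
  have outside: "p * card (carrier G - H) = (p - 1) * ?N"
  proof -
    have "card (carrier G - H) = ?N - card H"
      using fin_mem[OF H] sub[OF H] by (simp add: card_Diff_subset subgroup.subset)
    then show ?thesis using H_index by (simp add: diff_mult_distrib diff_mult_distrib2)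
  qed
  have "(\<Sum>K\<in>?F. p * (p * card (K - H))) \<le> p * ((p - 1) * ?N)"
    using sum_mono[of ?F "\<lambda>K. p * (p * card (K - H))" "\<lambda>_. (p - 1) * ?N"] diff' card_F'
    by simp
  then have "p * (p * (\<Sum>K\<in>?F. card (K - H))) \<le> p * (p * card (carrier G - H))"
    by (simp only: outside sum_distrib_left)
  then have upper: "(\<Sum>K\<in>?F. card (K - H)) \<le> card (carrier G - H)"
    using p2 by simp
  have out_cover: "carrier G - H \<subseteq> (\<Union>K\<in>?F. K - H)" using cover by blast
  have fin_U: "finite (\<Union>K\<in>?F. K - H)" using finF fin_mem by auto
  have lower: "card (carrier G - H) \<le> (\<Sum>K\<in>?F. card (K - H))"
    using card_mono[OF fin_U out_cover] card_UN_le[of ?F "\<lambda>K. K - H"] finF by simp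
  \<comment> \<open>As \<open>diff'\<close> bounds each summand on the left by the one on the right,
    equality of the sums gives equality term by term.\<close>
  have sum_eq: "(\<Sum>K\<in>?F. p * (p * card (K - H))) = (\<Sum>K\<in>?F. (p - 1) * ?N)"
    using upper lower outside card_F' by (simp flip: sum_distrib_left)
  show "p * card K = card (carrier G)" if K: "K \<in> F"
  proof (cases "K = H")
    case False
    have "p * (p * card (K - H)) = (p - 1) * ?N"
      by (rule sum_mono_inv[OF sum_eq]) (use K False finF diff' in auto)
    moreover have "p * (p * card (K - H)) \<le> p * ((p - 1) * card K)" using diff[OF K] by simp
    ultimately have "(p - 1) * ?N \<le> (p - 1) * (p * card K)" by (simp add: ac_simps)
    then have "?N \<le> p * card K" using p2 by simp
    with small[OF K] show ?thesis by simp
  qed (use H_index in simp)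
  show "K \<inter> L \<subseteq> H" if KL: "K \<in> F" "L \<in> F" "K \<noteq> L" "K \<noteq> H" "L \<noteq> H"
  proof (rule ccontr)
    assume "\<not> K \<inter> L \<subseteq> H"
    then obtain x where x: "x \<in> K" "x \<in> L" "x \<notin> H" by blast
    \<comment> \<open>Dropping \<open>x\<close> from \<open>K - H\<close> still leaves a cover of
      \<open>carrier G - H\<close>, because \<open>L\<close> contains \<open>x\<close>; but its
      total size is now strictly below what is required.\<close>
    let ?A = "\<lambda>M. if M = K then K - H - {x} else M - H"
    have "carrier G - H \<subseteq> (\<Union>M\<in>?F. ?A M)"
    proof
      fix y assume y: "y \<in> carrier G - H"
      then obtain M where "M \<in> ?F" "y \<in> M - H" using out_cover by blast
      then show "y \<in> (\<Union>M\<in>?F. ?A M)"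
        using KL x by (cases "y = x") auto
    qed
    moreover have "finite (\<Union>M\<in>?F. ?A M)" using finF fin_mem by auto
    ultimately have "card (carrier G - H) \<le> card (\<Union>M\<in>?F. ?A M)" by (intro card_mono)
    also have "\<dots> \<le> (\<Sum>M\<in>?F. card (?A M))" using finF by (intro card_UN_le) simp
    also have "\<dots> < (\<Sum>M\<in>?F. card (M - H))"
    proof (rule sum_strict_mono_ex1)
      show "\<forall>M\<in>?F. card (?A M) \<le> card (M - H)"
        using fin_mem by (auto intro: card_mono)
      show "\<exists>M\<in>?F. card (?A M) < card (M - H)"
      proof (rule bexI)
        have "card (K - H - {x}) < card (K - H)"
          using x fin_mem[OF KL(1)] by (intro card_Diff1_less) auto
        then show "card (?A K) < card (K - H)" by simp
      qed (use KL in simp)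
    qed (use finF in simp)
    finally show False using upper by simp
  qed
qed

lemma (in group) subgroup_cover_inter:
  assumes p: "prime p" and fin: "finite (carrier G)" and ord: "Coset.order G = p ^ k"
    and card_F: "card F = p + 1" and cover: "carrier G \<subseteq> \<Union>F"
    and sub: "\<And>K. K \<in> F \<Longrightarrow> subgroup K G"
    and proper: "\<And>K. K \<in> F \<Longrightarrow> K \<noteq> carrier G"
    and KL: "K \<in> F" "L \<in> F" "K \<noteq> L" and M: "M \<in> F"
  shows "K \<inter> L \<subseteq> M"
proof -
  let ?N = "card (carrier G)"
  have p2: "p \<ge> 2" using p by (rule prime_ge_2_nat)
  have N_pos: "?N > 0" using fin by (metis card_gt_0_iff empty_iff one_closed)
  have finF: "finite F" using card_F by (metis Suc_eq_plus1 card.infinite nat.distinct(1))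
  have dich: "p * card H = ?N \<or> p * p * card H \<le> ?N" if "H \<in> F" for H
    using card_proper_subgroup_p_group[OF p fin ord sub proper] that by blast
  have small: "p * card H \<le> ?N" if "H \<in> F" for H
  proof -
    have "p * card H \<le> p * p * card H" using p2 by simp
    then show ?thesis using dich[OF that] by linarith
  qed
  \<comment> \<open>Otherwise all indices are at least \<open>p * p\<close>, and covering
    \<open>G\<close> with \<open>p + 1\<close> members would need \<open>p * p \<le> p + 1\<close>,
    which fails for \<open>p \<ge> 2\<close>.\<close>
  have "\<exists>H\<in>F. p * card H = ?N"
  proof (rule ccontr)
    assume "\<not> ?thesis"
    then have "p * p * card H \<le> ?N" if "H \<in> F" for H using dich that by blast
    then have "(\<Sum>H\<in>F. p * p * card H) \<le> (p + 1) * ?N"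
      using sum_mono[of F "\<lambda>H. p * p * card H" "\<lambda>_. ?N"] card_F by simp
    moreover have "?N \<le> (\<Sum>H\<in>F. card H)"
    proof -
      have "finite (\<Union>F)" using finF sub fin by (meson finite_Union finite_subset subgroup.subset)
      then have "?N \<le> card (\<Union>F)" using cover card_mono by blast
      also have "\<dots> \<le> (\<Sum>H\<in>F. card H)" by (rule card_Union_le_sum_card)
      finally show ?thesis .
    qed
    ultimately have "p * p * ?N \<le> (p + 1) * ?N"
      by (metis mult_le_mono2 order_trans sum_distrib_left)
    then have "p * p \<le> p + 1" using N_pos by (simp only: mult_le_cancel2)
    moreover have "2 * p \<le> p * p" using p2 by simp
    ultimately show False using p2 by linarith
  qed
  then obtain H where H: "H \<in> F" "p * card H = ?N" by blast
  \<comment> \<open>Tightness gives every member index \<open>p\<close>, so \<open>M\<close> itself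
    can take the place of the distinguished subgroup. If \<open>M\<close> is \<open>K\<close> or
    \<open>L\<close>, the inclusion is immediate.\<close>
  have "p * card M = ?N"
    by (rule subgroup_cover_tight(1)[OF p fin card_F cover sub small H M])
  then show ?thesis
    using subgroup_cover_tight(2)[OF p fin card_F cover sub small M _ KL(1,2,3)] by blast
qed

section \<open>Centralizers\<close>

lemma (in group) subgroup_centralizer:
  assumes x: "x \<in> carrier G"
  shows "subgroup (centralizer G x) G"
proof (rule subgroupI)
  show "centralizer G x \<noteq> {}" using x by (auto simp: centralizer_def)
next
  fix a assume "a \<in> centralizer G x"
  then have a: "a \<in> carrier G" "x \<otimes> a = a \<otimes> x" by (auto simp: centralizer_def)
  then have "x \<otimes> inv a = inv a \<otimes> x"
    using x by (metis inv_closed inv_solve_left inv_solve_right m_assoc m_closed)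
  then show "inv a \<in> centralizer G x" using a by (simp add: centralizer_def)
next
  fix a b assume "a \<in> centralizer G x" "b \<in> centralizer G x"
  then show "a \<otimes> b \<in> centralizer G x"
    using x by (auto simp: centralizer_def) (metis m_assoc)
qed (auto simp: centralizer_def)

lemma centralizer_eq_carrier_iff:
  assumes "x \<in> carrier G"
  shows "centralizer G x = carrier G \<longleftrightarrow> x \<in> center G"
  using assms by (auto simp: centralizer_def center_def)

text \<open>The proper centralizers form a cover to which \<open>subgroup_cover_inter\<close>
  applies, so an element of two distinct ones lies in all of them. It then commutes with every
  noncentral element, hence with everything.\<close>

lemma (in group) centralizer_inter_subset_center:
  assumes p: "prime p" and fin: "finite (carrier G)" and ord: "Coset.order G = p ^ k"
    and card: "card (centralizer G ` carrier G) = p + 2"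
    and x: "x \<in> carrier G - center G" and y: "y \<in> carrier G - center G"
    and neq: "centralizer G x \<noteq> centralizer G y"
  shows "centralizer G x \<inter> centralizer G y \<subseteq> center G"
proof -
  define F where "F = centralizer G ` carrier G - {carrier G}"
  have "centralizer G \<one> = carrier G" by (auto simp: centralizer_def)
  then have "carrier G \<in> centralizer G ` carrier G" by (metis imageI one_closed)
  \<comment> \<open>Of the \<open>p + 2\<close> centralizers, only the whole group, as the
    centralizer of \<open>\<one>\<close>, is discarded.\<close>
  then have card_F: "card F = p + 1" using card fin by (simp add: F_def)
  have mem_F: "centralizer G z \<in> F" if "z \<in> carrier G - center G" for z
    using that centralizer_eq_carrier_iff[of z G] by (auto simp: F_def)
  have cover: "carrier G \<subseteq> \<Union>F"
  proof
    fix z assume z: "z \<in> carrier G"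
    show "z \<in> \<Union>F"
    proof (cases "z \<in> center G")
      case True
      then have "z \<in> centralizer G x" using x by (auto simp: centralizer_def center_def)
      then show ?thesis using mem_F[OF x] by blast
    next
      case False
      moreover have "z \<in> centralizer G z" using z by (simp add: centralizer_def)
      ultimately show ?thesis using mem_F[of z] z by blast
    qed
  qed
  have inter: "centralizer G x \<inter> centralizer G y \<subseteq> M" if "M \<in> F" for M
    by (rule subgroup_cover_inter[OF p fin ord card_F cover _ _ mem_F[OF x] mem_F[OF y] neq that])
      (auto simp: F_def intro: subgroup_centralizer)
  show ?thesis
  proof
    fix g assume g: "g \<in> centralizer G x \<inter> centralizer G y"
    then have "g \<in> carrier G" by (simp add: centralizer_def)
    moreover have "g \<otimes> h = h \<otimes> g" if h: "h \<in> carrier G" for h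
    proof (cases "h \<in> center G")
      case False
      then show ?thesis using inter[OF mem_F[of h]] g h by (auto simp: centralizer_def)
    qed (use \<open>g \<in> carrier G\<close> in \<open>simp add: center_def\<close>)
    ultimately show "g \<in> center G" by (simp add: center_def)
  qed
qed

section \<open>The Laplacian of a complete multipartite graph\<close>

lemma laplacian_mat_mult_vec:
  assumes D: "pair_graph D" and vs: "distinct vs" "set vs = pverts D"
    and v: "v \<in> carrier_vec (length vs)" and i: "i < length vs"
  shows "(laplacian_mat D vs *\<^sub>v v) $ i =
    (\<Sum>j\<in>{j. j < length vs \<and> (vs ! i, vs ! j) \<in> parcs D}. v $ i - v $ j)"
proof -
  interpret pair_graph D by fact
  let ?n = "length vs" and ?A = "{j. j < length vs \<and> (vs ! i, vs ! j) \<in> parcs D}"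
  \<comment> \<open>The degree counts arcs while the sum runs over indices; as \<open>vs\<close>
    enumerates the vertices without repetition, both counts agree, and the diagonal entry
    contributes one \<open>v $ i\<close> per neighbour.\<close>
  have "bij_betw (\<lambda>j. (vs ! i, vs ! j)) ?A (out_arcs (with_proj D) (vs ! i))"
  proof (rule bij_betw_imageI)
    show "inj_on (\<lambda>j. (vs ! i, vs ! j)) ?A"
      using vs(1) by (auto simp: inj_on_def nth_eq_iff_index_eq)
    show "(\<lambda>j. (vs ! i, vs ! j)) ` ?A = out_arcs (with_proj D) (vs ! i)"
    proof
      show "out_arcs (with_proj D) (vs ! i) \<subseteq> (\<lambda>j. (vs ! i, vs ! j)) ` ?A"
      proof
        fix e assume "e \<in> out_arcs (with_proj D) (vs ! i)"
        then obtain w where w: "e = (vs ! i, w)" "(vs ! i, w) \<in> parcs D"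
          by (cases e) auto
        then have "w \<in> set vs" using in_arcsD2 vs(2) by blast
        then obtain j where "j < ?n" "vs ! j = w" by (auto simp: in_set_conv_nth)
        then show "e \<in> (\<lambda>j. (vs ! i, vs ! j)) ` ?A" using w by blast
      qed
    qed (use vs(2) in auto)
  qed
  then have deg: "out_degree (with_proj D) (vs ! i) = card ?A"
    unfolding out_degree_def by (rule bij_betw_same_card[symmetric])
  have "(laplacian_mat D vs *\<^sub>v v) $ i =
      (\<Sum>j<?n. ((if i = j then of_nat (card ?A) else 0) - (if j \<in> ?A then 1 else 0)) * v $ j)"
  proof -
    have "(laplacian_mat D vs *\<^sub>v v) $ i = (\<Sum>j<?n. laplacian_mat D vs $$ (i, j) * v $ j)"
      using i v
      by (simp add: laplacian_mat_def degree_mat_def adjacency_mat_def scalar_prod_def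
          lessThan_atLeast0)
    also have "\<dots> = (\<Sum>j<?n. ((if i = j then of_nat (card ?A) else 0)
        - (if j \<in> ?A then 1 else 0)) * v $ j)"
    proof (rule sum.cong)
      fix j assume "j \<in> {..<?n}"
      then show "laplacian_mat D vs $$ (i, j) * v $ j =
          ((if i = j then of_nat (card ?A) else 0) - (if j \<in> ?A then 1 else 0)) * v $ j"
        unfolding deg[symmetric]
        using i by (simp add: laplacian_mat_def degree_mat_def adjacency_mat_def)
    qed simp
    finally show ?thesis .
  qed
  also have "\<dots> = (\<Sum>j<?n. if i = j then of_nat (card ?A) * v $ j else 0)
      - (\<Sum>j<?n. if j \<in> ?A then v $ j else 0)"
    unfolding sum_subtractf[symmetric] by (rule sum.cong) (auto simp: left_diff_distrib)
  also have "(\<Sum>j<?n. if j \<in> ?A then v $ j else 0) = (\<Sum>j\<in>?A. v $ j)"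
    by (rule sum.mono_neutral_cong_right) auto
  also have "(\<Sum>j<?n. if i = j then of_nat (card ?A) * v $ j else 0) = of_nat (card ?A) * v $ i"
    using i by simp
  finally show ?thesis by (simp add: sum_subtractf)
qed

text \<open>Here \<open>C i\<close> is the part of vertex \<open>i\<close>, \<open>T i\<close> the
  sum of the eigenvector over that part and \<open>S\<close> its sum over all vertices. Three linear
  relations between \<open>f i\<close>, \<open>T i\<close> and \<open>S\<close> leave only integer
  values for \<open>k\<close>.\<close>

lemma complete_multipartite_eigenvalue:
  fixes R :: "nat \<Rightarrow> nat \<Rightarrow> bool" and f :: "nat \<Rightarrow> complex"
  assumes sym: "\<And>i j. R i j \<Longrightarrow> R j i"
    and trans: "\<And>i j l. \<lbrakk>i < n; j < n; l < n; \<not> R i j; \<not> R j l\<rbrakk> \<Longrightarrow> \<not> R i l"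
    and eig: "\<And>i. i < n \<Longrightarrow> (\<Sum>j\<in>{j. j < n \<and> R i j}. f i - f j) = k * f i"
    and nz: "i0 < n" "f i0 \<noteq> 0"
  shows "k \<in> \<int>"
proof -
  define C where "C i = {j. j < n \<and> \<not> R i j}" for i
  define S where "S = (\<Sum>j<n. f j)"
  define T where "T i = (\<Sum>j\<in>C i. f j)" for i
  have finC: "finite (C i)" for i by (simp add: C_def)
  have C_eq: "C j = C i" if "i < n" "j \<in> C i" for i j
    using that trans sym unfolding C_def by blast
  have eq: "k * f i = (of_nat n - of_nat (card (C i))) * f i - S + T i" if i: "i < n" for i
  proof -
    have "{..<n} = {j. j < n \<and> R i j} \<union> C i" "{j. j < n \<and> R i j} \<inter> C i = {}"
      by (auto simp: C_def)
    then have "(\<Sum>j<n. f i - f j) = (\<Sum>j\<in>{j. j < n \<and> R i j}. f i - f j) + (\<Sum>j\<in>C i. f i - f j)"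
      using finC by (simp add: sum.union_disjoint)
    moreover have "(\<Sum>j<n. f i - f j) = of_nat n * f i - S"
      by (simp add: sum_subtractf S_def)
    moreover have "(\<Sum>j\<in>C i. f i - f j) = of_nat (card (C i)) * f i - T i"
      by (simp add: sum_subtractf T_def)
    ultimately show ?thesis
      by (simp add: eig[OF i] algebra_simps)
  qed
  \<comment> \<open>Sum \<open>eq\<close> over the part of \<open>i\<close>: \<open>C\<close> and
    \<open>T\<close> are constant there, and the two multiples of \<open>T i\<close> by the size of
    the part cancel.\<close>
  have part: "k * T i = of_nat n * T i - of_nat (card (C i)) * S" if i: "i < n" for i
  proof -
    have "k * T i = (\<Sum>j\<in>C i. k * f j)" by (simp add: T_def sum_distrib_left)
    also have "\<dots> = (\<Sum>j\<in>C i. (of_nat n - of_nat (card (C i))) * f j - S + T i)"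
    proof (rule sum.cong)
      fix j assume j: "j \<in> C i"
      then have "j < n" by (simp add: C_def)
      then show "k * f j = (of_nat n - of_nat (card (C i))) * f j - S + T i"
        using eq[of j] C_eq[OF i j] by (simp add: T_def)
    qed simp
    also have "\<dots> = (of_nat n - of_nat (card (C i))) * T i - of_nat (card (C i)) * S
        + of_nat (card (C i)) * T i"
      by (simp add: sum.distrib sum_subtractf sum_distrib_left T_def)
    finally show ?thesis by (simp add: algebra_simps)
  qed
  have total: "k * S = 0"
  proof -
    \<comment> \<open>Extension by zero makes both summation ranges fixed, so they can be swapped;
      symmetry of \<open>R\<close> makes \<open>g\<close> antisymmetric, whence
      \<open>k * S = - (k * S)\<close>.\<close>
    define g where "g i j = (if R i j then f i - f j else 0)" for i j
    have "(\<Sum>i<n. k * f i) = (\<Sum>i<n. \<Sum>j<n. g i j)"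
    proof (rule sum.cong)
      fix i assume "i \<in> {..<n}"
      then have "k * f i = (\<Sum>j\<in>{j. j < n \<and> R i j}. f i - f j)" using eig by simp
      also have "\<dots> = (\<Sum>j<n. g i j)"
        by (rule sum.mono_neutral_cong_left) (auto simp: g_def)
      finally show "k * f i = (\<Sum>j<n. g i j)" .
    qed simp
    then have kS: "k * S = (\<Sum>i<n. \<Sum>j<n. g i j)" by (simp add: S_def sum_distrib_left)
    also have "\<dots> = (\<Sum>j<n. \<Sum>i<n. g i j)" by (rule sum.swap)
    also have "\<dots> = (\<Sum>j<n. \<Sum>i<n. - g j i)"
      using sym by (intro sum.cong refl) (auto simp: g_def)
    also have "\<dots> = - (k * S)" by (simp add: kS sum_negf)
    finally show ?thesis by auto
  qed
  show ?thesis
  proof (cases "k = 0 \<or> k = of_nat n")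
    \<comment> \<open>From \<open>k \<noteq> 0\<close> follows \<open>S = 0\<close>, then from
      \<open>k \<noteq> n\<close> follows \<open>T i0 = 0\<close>; what remains of \<open>eq\<close>
      at \<open>i0\<close> can be divided by \<open>f i0\<close>.\<close>
    case False
    then have "S = 0" using total by simp
    then have "T i0 = 0" using part[OF nz(1)] False by simp
    then have "k = of_nat n - of_nat (card (C i0))"
      using eq[OF nz(1)] \<open>S = 0\<close> nz(2) by simp
    then show ?thesis by simp
  qed auto
qed

text \<open>Transitive non-adjacency, with the symmetry of arcs, puts the eigenvalue equation read
  coordinate by coordinate into the scope of
  \<open>complete_multipartite_eigenvalue\<close>.\<close>

lemma L_integral_complete_multipartite:
  assumes D: "pair_graph D"
    and trans: "\<And>x y z. \<lbrakk>x \<in> pverts D; y \<in> pverts D; z \<in> pverts D;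
      (x, y) \<notin> parcs D; (y, z) \<notin> parcs D\<rbrakk> \<Longrightarrow> (x, z) \<notin> parcs D"
  shows "L_integral D"
  unfolding L_integral_def
proof (intro conjI allI impI)
  interpret pair_graph D by fact
  fix vs k
  assume "distinct vs \<and> set vs = pverts D" and "eigenvalue (laplacian_mat D vs) k"
  then have vs: "distinct vs" "set vs = pverts D" by auto
  let ?n = "length vs"
  have dim: "dim_row (laplacian_mat D vs) = ?n"
    by (simp add: laplacian_mat_def degree_mat_def adjacency_mat_def)
  obtain v where v: "v \<in> carrier_vec ?n" "v \<noteq> 0\<^sub>v ?n"
    and eig: "laplacian_mat D vs *\<^sub>v v = k \<cdot>\<^sub>v v"
    using \<open>eigenvalue (laplacian_mat D vs) k\<close> dim by (auto simp: eigenvalue_def eigenvector_def)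
  have "\<exists>i0 < ?n. v $ i0 \<noteq> 0"
  proof (rule ccontr)
    assume "\<not> ?thesis"
    then have "v = 0\<^sub>v ?n" using v(1) by (intro eq_vecI) auto
    with v(2) show False by simp
  qed
  then obtain i0 where i0: "i0 < ?n" "v $ i0 \<noteq> 0" by blast
  show "k \<in> \<int>"
  proof (rule complete_multipartite_eigenvalue[where f = "\<lambda>i. v $ i" and n = ?n
        and R = "\<lambda>i j. (vs ! i, vs ! j) \<in> parcs D" and k = k, OF _ _ _ i0])
    fix i assume "i < ?n"
    then show "(\<Sum>j\<in>{j. j < ?n \<and> (vs ! i, vs ! j) \<in> parcs D}. v $ i - v $ j) = k * v $ i"
      using laplacian_mat_mult_vec[OF D vs v(1)] eig v(1) by simp
  next
    fix i j l
    assume "i < ?n" "j < ?n" "l < ?n"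
      "(vs ! i, vs ! j) \<notin> parcs D" "(vs ! j, vs ! l) \<notin> parcs D"
    then show "(vs ! i, vs ! l) \<notin> parcs D"
      using trans[of "vs ! i" "vs ! j" "vs ! l"] by (simp flip: vs(2))
  next
    fix i j assume "(vs ! i, vs ! j) \<in> parcs D"
    then show "(vs ! j, vs ! i) \<in> parcs D" by (rule arcs_symmetric)
  qed
qed (rule D)

theorem proposition5p2:
  fixes p :: nat and G :: "('a, 'b) monoid_scheme"
  assumes "prime p"
    and "finite_p_group p G"
    and "n_centralizer_group (p + 2) G"
  shows "L_integral (non_commuting_graph G)"
proof -
  obtain k where "group G" and fin: "finite (carrier G)" and ord: "Coset.order G = p ^ k"
    using assms(2) by (auto simp: finite_p_group_def)
  interpret group G by fact
  have card: "card (centralizer G ` carrier G) = p + 2"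
    using assms(3) by (simp add: n_centralizer_group_def)
  \<comment> \<open>If \<open>x\<close> and \<open>y\<close> commute, the noncentral
    \<open>x\<close> lies in both centralizers, which distinct centralizers do not allow. So
    non-adjacency of vertices amounts to equality of centralizers, and this is transitive.\<close>
  have same: "centralizer G x = centralizer G y"
    if x: "x \<in> carrier G - center G" and y: "y \<in> carrier G - center G"
      and xy: "x \<otimes>\<^bsub>G\<^esub> y = y \<otimes>\<^bsub>G\<^esub> x" for x y
  proof (rule ccontr)
    assume "centralizer G x \<noteq> centralizer G y"
    then have "centralizer G x \<inter> centralizer G y \<subseteq> center G"
      by (rule centralizer_inter_subset_center[OF assms(1) fin ord card x y])
    moreover have "x \<in> centralizer G x \<inter> centralizer G y"
      using x y xy by (simp add: centralizer_def)
    ultimately show False using x by blast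
  qed
  show ?thesis
  proof (rule L_integral_complete_multipartite[OF pair_graph_non_commuting_graph[OF fin]])
    fix x y z
    assume "x \<in> pverts (non_commuting_graph G)" "y \<in> pverts (non_commuting_graph G)"
      "z \<in> pverts (non_commuting_graph G)"
      and "(x, y) \<notin> parcs (non_commuting_graph G)" "(y, z) \<notin> parcs (non_commuting_graph G)"
    then have V: "x \<in> carrier G - center G" "y \<in> carrier G - center G" "z \<in> carrier G - center G"
      and "x \<otimes>\<^bsub>G\<^esub> y = y \<otimes>\<^bsub>G\<^esub> x" and yz: "y \<otimes>\<^bsub>G\<^esub> z = z \<otimes>\<^bsub>G\<^esub> y"
      by (auto simp: non_commuting_graph_def)
    then have "centralizer G x = centralizer G y" using same by blast
    moreover have "z \<in> centralizer G y" using V yz by (simp add: centralizer_def)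
    ultimately have "x \<otimes>\<^bsub>G\<^esub> z = z \<otimes>\<^bsub>G\<^esub> x" by (auto simp: centralizer_def)
    then show "(x, z) \<notin> parcs (non_commuting_graph G)" by (simp add: non_commuting_graph_def)
  qed
qed

end
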